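(* Consider a Markov decision process with state space $\mathbb{S}$ and action space $\mathbb{U}$. Let $\nu$ be an initial probability distribution on $\mathbb{S}$, and let $\pi=(\pi_t)_{t}$ and $\breve{\pi}=(\breve{\pi}_t)_{t}$ be two admissible control policies (the honest policy, corresponding to all actuators being honest, and the corrupt policy, corresponding to at least one actuator being malicious; no restriction is placed on the functional form of either). Let $\mathsf{P}^{\pi}_{\nu}$ and $\mathsf{P}^{\breve{\pi}}_{\nu}$ be the corresponding laws of the state trajectory on $\Omega_s=\mathbb{S}^{\{0,1,2,\ldots\}}$, and let $\mathsf{Q}_n$ and $\breve{\mathsf{Q}}_n$ be the restrictions of $\mathsf{P}^{\pi}_{\nu}$ and $\mathsf{P}^{\breve{\pi}}_{\nu}$, respectively, to $\mathcal{G}_n$, the $\sigma$-algebra generated by the first $n+1$ states. Assume that $\mathsf{Q}_n\ll\breve{\mathsf{Q}}_n$ for each $n$. Then there exists a separator, i.e., a Borel measurable map $\Sigma:\Omega_s\to\{0,1\}$ such that $\Sigma(\omega_s)=0$ for $\mathsf{P}^{\pi}_{\nu}$-almost every $\omega_s$ and $\Sigma(\breve{\omega}_s)=1$ for $\mathsf{P}^{\breve{\pi}}_{\nu}$-almost every $\breve{\omega}_s$, if and only if $$\frac{d\mathsf{Q}_n}{d\breve{\mathsf{Q}}_n}\xrightarrow[n\to+\infty]{}0\qquad \mathsf{P}^{\breve{\pi}}_{\nu}\text{-almost surely},$$ where $\frac{d\mathsf{Q}_n}{d\breve{\mathsf{Q}}_n}$ is the Radon-Nikodym derivative of $\mathsf{Q}_n$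 relative to $\breve{\mathsf{Q}}_n$.
   Context: Time is indexed by $t\in\{0,1,2,\ldots\}$. $\mathbb{S}$ and $\mathbb{U}$ are nonempty Borel subsets of Euclidean spaces. An admissible policy is a sequence $\pi=(\pi_t)_t$ of stochastic kernels on $\mathbb{U}$ given the history $\overline{h}_t=(x_0,u_0,x_1,u_1,\ldots,u_{t-1},x_t)$, with $\pi_t(\overline{h}_t;\mathbb{U})=1$. On the canonical space $\Omega=(\mathbb{S}\times\mathbb{U})^{\{0,1,\ldots\}}$ with its Borel $\sigma$-algebra, let $X_t(\omega)=x_t$, $U_t(\omega)=u_t$, $\overline{H}_t(\omega)=\overline{h}_t$ for $\omega=(x_0,u_0,x_1,u_1,\ldots)$. Given an initial distribution $\nu$ on $\mathbb{S}$, the transition law of the MDP (a stochastic kernel for the next state given the current state and action, the same under every policy) and a policy $\pi$, $\mathsf{R}^{\pi}_{\nu}$ is the probability measure on $\Omega$ such that for all $t$ and Borel $S_0,S_1\subset\mathbb{S}$, $T\subset\mathbb{U}$: $\mathsf{R}^{\pi}_{\nu}(X_0\in S_0)=\nu(S_0)$, $\mathsf{R}^{\pi}_{\nu}(U_t\in T\mid\overline{H}_t)=\pi_t(\overline{H}_t;T)$, and $\mathsf{R}^{\pi}_{\nu}(X_{t+1}\in S_1\mid\overline{H}_t,U_t)=\mathsf{R}^{\pi}_{\nu}(X_{t+1}\in S_1\mid X_t,U_t)$ (given by the transition law). $\Omega_s=\mathbb{S}^{\{0,1,\ldots\}}$ carries its Borel (product) $\sigma$-algebra; $\mathcal{G}_n$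 is the $\sigma$-algebra on $\Omega_s$ generated by $(x_0,x_1,\ldots)\mapsto(x_0,\ldots,x_n)$. $\mathsf{P}^{\pi}_{\nu}$ is the law on $\Omega_s$ of the state process $(X_t)_t$ under $\mathsf{R}^{\pi}_{\nu}$ (controls marginalized out), and $\mathsf{P}^{\breve{\pi}}_{\nu}$ is defined likewise from $\breve{\pi}$ with the same $\nu$ and the same transition law. $\mathsf{P}\ll\mathsf{P}'$ denotes absolute continuity of $\mathsf{P}$ with respect to $\mathsf{P}'$. *)

theory Defs
  imports "HOL-Probability.Probability"
begin

text \<open>Throughout, \<open>S\<close> and \<open>U\<close> are the state and action spaces, as subsets of Euclidean spaces,
  with the Borel \<open>\<sigma>\<close>-algebras of the subspaces. A sample point of the canonical space is a
  sequence \<open>\<omega>\<close> of pairs, \<open>\<omega> t = (x\<^sub>t, u\<^sub>t)\<close>.\<close>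

abbreviation borel_on :: "'a::topological_space set \<Rightarrow> 'a measure" where
  "borel_on S \<equiv> restrict_space borel S"

definition canonical_space ::
    "'a::euclidean_space set \<Rightarrow> 'b::euclidean_space set \<Rightarrow> (nat \<Rightarrow> 'a \<times> 'b) measure" where
  "canonical_space S U = (\<Pi>\<^sub>M t\<in>UNIV. borel_on S \<Otimes>\<^sub>M borel_on U)"

definition state_at :: "nat \<Rightarrow> (nat \<Rightarrow> 'a \<times> 'b) \<Rightarrow> 'a" where
  "state_at t \<omega> = fst (\<omega> t)"

definition action_at :: "nat \<Rightarrow> (nat \<Rightarrow> 'a \<times> 'b) \<Rightarrow> 'b" where
  "action_at t \<omega> = snd (\<omega> t)"

text \<open>The history \<open>(x\<^sub>0, u\<^sub>0, \<dots>, u\<^bsub>t-1\<^esub>, x\<^sub>t)\<close> is stored as the pair of the state sequence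
  indexed by \<open>{..t}\<close> and the action sequence indexed by \<open>{..<t}\<close>.\<close>

definition history_space ::
    "'a::euclidean_space set \<Rightarrow> 'b::euclidean_space set \<Rightarrow> nat
      \<Rightarrow> ((nat \<Rightarrow> 'a) \<times> (nat \<Rightarrow> 'b)) measure" where
  "history_space S U t = (\<Pi>\<^sub>M i\<in>{..t}. borel_on S) \<Otimes>\<^sub>M (\<Pi>\<^sub>M i\<in>{..<t}. borel_on U)"

definition history :: "nat \<Rightarrow> (nat \<Rightarrow> 'a \<times> 'b) \<Rightarrow> (nat \<Rightarrow> 'a) \<times> (nat \<Rightarrow> 'b)" where
  "history t \<omega> = (\<lambda>i\<in>{..t}. state_at i \<omega>, \<lambda>i\<in>{..<t}. action_at i \<omega>)"

definition admissible_policy ::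
    "'a::euclidean_space set \<Rightarrow> 'b::euclidean_space set
      \<Rightarrow> (nat \<Rightarrow> (nat \<Rightarrow> 'a) \<times> (nat \<Rightarrow> 'b) \<Rightarrow> 'b measure) \<Rightarrow> bool" where
  "admissible_policy S U \<pi> \<longleftrightarrow> (\<forall>t. \<pi> t \<in> history_space S U t \<rightarrow>\<^sub>M prob_algebra (borel_on U))"

definition transition_law ::
    "'a::euclidean_space set \<Rightarrow> 'b::euclidean_space set \<Rightarrow> ('a \<times> 'b \<Rightarrow> 'a measure) \<Rightarrow> bool" where
  "transition_law S U \<kappa> \<longleftrightarrow> \<kappa> \<in> borel_on S \<Otimes>\<^sub>M borel_on U \<rightarrow>\<^sub>M prob_algebra (borel_on S)"

text \<open>Conditional probability of the event \<open>A\<close> given the \<open>N\<close>-valued random element \<open>Y\<close>; a version,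
  hence only meaningful up to \<open>R\<close>-null sets.\<close>

definition cond_prob_given ::
    "'w measure \<Rightarrow> ('w \<Rightarrow> 'y) \<Rightarrow> 'y measure \<Rightarrow> 'w set \<Rightarrow> 'w \<Rightarrow> real" where
  "cond_prob_given R Y N A = real_cond_exp R (vimage_algebra (space R) Y N) (indicator A)"

text \<open>\<open>R\<close> is the probability measure on the canonical space induced by the initial distribution
  \<open>\<nu>\<close>, the transition law \<open>\<kappa>\<close> and the policy \<open>\<pi>\<close>. These conditions determine \<open>R\<close> uniquely.\<close>

definition mdp_law ::
    "'a::euclidean_space set \<Rightarrow> 'b::euclidean_space set \<Rightarrow> ('a \<times> 'b \<Rightarrow> 'a measure) \<Rightarrow> 'a measure
      \<Rightarrow> (nat \<Rightarrow> (nat \<Rightarrow> 'a) \<times> (nat \<Rightarrow> 'b) \<Rightarrow> 'b measure) \<Rightarrow> (nat \<Rightarrow> 'a \<times> 'b) measure \<Rightarrow> bool" where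
  "mdp_law S U \<kappa> \<nu> \<pi> R \<longleftrightarrow>
     prob_space R \<and> sets R = sets (canonical_space S U) \<and>
     (\<forall>A\<in>sets (borel_on S). measure R {\<omega> \<in> space R. state_at 0 \<omega> \<in> A} = measure \<nu> A) \<and>
     (\<forall>t. \<forall>B\<in>sets (borel_on U). AE \<omega> in R.
        cond_prob_given R (history t) (history_space S U t)
          {\<omega> \<in> space R. action_at t \<omega> \<in> B} \<omega> = measure (\<pi> t (history t \<omega>)) B) \<and>
     (\<forall>t. \<forall>A\<in>sets (borel_on S). AE \<omega> in R.
        cond_prob_given R (\<lambda>\<omega>. (history t \<omega>, action_at t \<omega>)) (history_space S U t \<Otimes>\<^sub>M borel_on U)
          {\<omega> \<in> space R. state_at (Suc t) \<omega> \<in> A} \<omega>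
        = cond_prob_given R (\<lambda>\<omega>. (state_at t \<omega>, action_at t \<omega>)) (borel_on S \<Otimes>\<^sub>M borel_on U)
          {\<omega> \<in> space R. state_at (Suc t) \<omega> \<in> A} \<omega>) \<and>
     (\<forall>t. \<forall>A\<in>sets (borel_on S). AE \<omega> in R.
        cond_prob_given R (\<lambda>\<omega>. (state_at t \<omega>, action_at t \<omega>)) (borel_on S \<Otimes>\<^sub>M borel_on U)
          {\<omega> \<in> space R. state_at (Suc t) \<omega> \<in> A} \<omega>
        = measure (\<kappa> (state_at t \<omega>, action_at t \<omega>)) A)"

definition trajectory_space :: "'a::euclidean_space set \<Rightarrow> (nat \<Rightarrow> 'a) measure" where
  "trajectory_space S = (\<Pi>\<^sub>M t\<in>UNIV. borel_on S)"

definition state_law ::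
    "'a::euclidean_space set \<Rightarrow> (nat \<Rightarrow> 'a \<times> 'b) measure \<Rightarrow> (nat \<Rightarrow> 'a) measure" where
  "state_law S R = distr R (trajectory_space S) (\<lambda>\<omega> t. state_at t \<omega>)"

definition state_filtration :: "'a::euclidean_space set \<Rightarrow> nat \<Rightarrow> (nat \<Rightarrow> 'a) measure" where
  "state_filtration S n =
     vimage_algebra (space (trajectory_space S)) (\<lambda>x. \<lambda>i\<in>{..n}. x i) (\<Pi>\<^sub>M i\<in>{..n}. borel_on S)"

definition separator ::
    "'a::euclidean_space set \<Rightarrow> (nat \<Rightarrow> 'a) measure \<Rightarrow> (nat \<Rightarrow> 'a) measure
      \<Rightarrow> ((nat \<Rightarrow> 'a) \<Rightarrow> nat) \<Rightarrow> bool" where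
  "separator S P P' \<Sigma>s \<longleftrightarrow>
     \<Sigma>s \<in> trajectory_space S \<rightarrow>\<^sub>M count_space {0, 1} \<and>
     (AE \<omega> in P. \<Sigma>s \<omega> = 0) \<and> (AE \<omega> in P'. \<Sigma>s \<omega> = 1)"

end

theory Submission
  imports Defs
begin

text \<open>
  The statement is about two probability measures \<open>P\<close>, \<open>P'\<close> on one measurable space and a filtration
  \<open>F\<close> that generates its \<open>\<sigma>\<close>-algebra, with \<open>P\<close> absolutely continuous with respect to \<open>P'\<close> on every
  \<open>F n\<close>. A separator is the indicator of a set \<open>A\<close> with \<open>P A = 0\<close> and \<open>P' A = 1\<close>, so the claim is
  that \<open>P\<close> and \<open>P'\<close> are mutually singular if and only if the likelihood ratios \<open>z n\<close>, the densities
  of \<open>P\<close> relative to \<open>P'\<close> on \<open>F n\<close>, tend to \<open>0\<close> almost surely under \<open>P'\<close>.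

  Both directions rest on the comparison of \<open>P\<close> and \<open>P'\<close> on sets of \<open>F n\<close> where \<open>z n\<close> is bounded
  from one side (\<open>emeasure_le_where_ratio_le\<close>, \<open>emeasure_ge_where_ratio_ge\<close>).

  If \<open>z n \<longlonglongrightarrow> 0\<close>, then along a sequence \<open>m k\<close> the events \<open>z (m k) > 2\<^sup>-\<^sup>k\<close> have \<open>P'\<close>-probability
  below \<open>2\<^sup>-\<^sup>k\<close>, while their complements have \<open>P\<close>-probability at most \<open>2\<^sup>-\<^sup>k\<close>, because the density is at
  most \<open>2\<^sup>-\<^sup>k\<close> there. By the Borel-Cantelli lemma, \<open>P'\<close>-almost every point lies in all but finitely many
  of these complements and \<open>P\<close>-almost every point in only finitely many of them.

  Conversely, let \<open>P A = 0\<close> and \<open>P' A = 1\<close>. As the filtration generates, \<open>A\<close> can be replaced, up to a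
  probability \<open>\<delta>\<close> under both laws, by some \<open>B\<close> in some \<open>F m\<close> (\<open>approximation_by_filtration\<close>). A
  maximal inequality on \<open>B\<close> for the ratios from time \<open>m\<close> on (\<open>maximal_inequality\<close>) shows
  that \<open>z n \<ge> c\<close> for some \<open>n \<ge> m\<close> has \<open>P'\<close>-probability at most \<open>P B / c < \<delta> / c\<close> within \<open>B\<close>. Hence
  the event that \<open>z n \<ge> c\<close> infinitely often has \<open>P'\<close>-probability at most
  \<open>\<delta> + \<delta> / c\<close> for every \<open>\<delta>\<close>, that is \<open>0\<close>.
\<close>

section \<open>Likelihood ratios along a filtration\<close>

locale likelihood_ratios = P: prob_space P + P': prob_space P'
  for P P' :: "'a measure" +
  fixes F :: "nat \<Rightarrow> 'a measure"
  assumes sets_P': "sets P' = sets P"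
    and subalgebra_F: "\<And>n. subalgebra P (F n)"
    and mono_F: "\<And>m n. m \<le> n \<Longrightarrow> sets (F m) \<subseteq> sets (F n)"
    and absolutely_continuous_F:
      "\<And>n. absolutely_continuous (restr_to_subalg P' (F n)) (restr_to_subalg P (F n))"
begin

definition ratio :: "nat \<Rightarrow> 'a \<Rightarrow> ennreal" where
  "ratio n = RN_deriv (restr_to_subalg P' (F n)) (restr_to_subalg P (F n))"

lemma space_P': "space P' = space P"
  using sets_P' by (rule sets_eq_imp_space_eq)

lemma subalgebra_F': "subalgebra P' (F n)"
  using subalgebra_F[of n] by (simp add: subalgebra_def sets_P' space_P')

lemma space_F [simp]: "space (F n) = space P"
  using subalgebra_F[of n] by (simp add: subalgebra_def)

lemma sets_F_P: "A \<in> sets (F n) \<Longrightarrow> A \<in> sets P"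
  using subalgebra_F[of n] by (auto simp: subalgebra_def)

lemma sets_F_P': "A \<in> sets (F n) \<Longrightarrow> A \<in> sets P'"
  by (simp add: sets_P' sets_F_P)

lemma measurable_ratio [measurable]: "ratio n \<in> borel_measurable (F n)"
proof -
  have "ratio n \<in> borel_measurable (restr_to_subalg P' (F n))"
    by (simp add: ratio_def)
  then show ?thesis
    by (simp add: measurable_cong_sets[OF sets_restr_to_subalg[OF subalgebra_F'] refl])
qed

lemma measurable_ratio_P' [measurable]: "ratio n \<in> borel_measurable P'"
  by (rule measurable_from_subalg[OF subalgebra_F' measurable_ratio])

lemma measurable_ratio_P [measurable]: "ratio n \<in> borel_measurable P"
  by (rule measurable_from_subalg[OF subalgebra_F measurable_ratio])

lemma emeasure_eq_integral_ratio:
  assumes A: "A \<in> sets (F n)"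
  shows "emeasure P A = (\<integral>\<^sup>+ x. ratio n x * indicator A x \<partial>P')"
proof -
  let ?Q = "restr_to_subalg P (F n)" and ?Q' = "restr_to_subalg P' (F n)"
  interpret Q': prob_space ?Q'
    by (rule prob_space_restr_to_subalg[OF subalgebra_F' P'.prob_space_axioms])
  have "density ?Q' (ratio n) = ?Q"
    unfolding ratio_def
    by (rule Q'.density_RN_deriv[OF absolutely_continuous_F])
      (simp add: sets_restr_to_subalg subalgebra_F subalgebra_F')
  then have "emeasure P A = emeasure (density ?Q' (ratio n)) A"
    using emeasure_restr_to_subalg[OF subalgebra_F A] by simp
  also have "\<dots> = (\<integral>\<^sup>+ x. ratio n x * indicator A x \<partial>?Q')"
    by (rule emeasure_density)
      (use A in \<open>auto simp: sets_restr_to_subalg subalgebra_F'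
        measurable_in_subalg[OF subalgebra_F' measurable_ratio]\<close>)
  also have "\<dots> = (\<integral>\<^sup>+ x. ratio n x * indicator A x \<partial>P')"
    using A by (intro nn_integral_subalgebra2[OF subalgebra_F']) simp
  finally show ?thesis .
qed

lemma emeasure_le_where_ratio_le:
  assumes A: "A \<in> sets (F n)" and le: "\<And>x. x \<in> A \<Longrightarrow> ratio n x \<le> c"
  shows "emeasure P A \<le> c * emeasure P' A"
proof -
  have "emeasure P A \<le> (\<integral>\<^sup>+ x. c * indicator A x \<partial>P')"
    unfolding emeasure_eq_integral_ratio[OF A]
    by (intro nn_integral_mono) (auto simp: indicator_def le)
  also have "\<dots> = c * emeasure P' A"
    using sets_F_P'[OF A] by (rule nn_integral_cmult_indicator)
  finally show ?thesis .
qed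

lemma emeasure_ge_where_ratio_ge:
  assumes A: "A \<in> sets (F n)" and ge: "\<And>x. x \<in> A \<Longrightarrow> c \<le> ratio n x"
  shows "c * emeasure P' A \<le> emeasure P A"
proof -
  have "c * emeasure P' A = (\<integral>\<^sup>+ x. c * indicator A x \<partial>P')"
    using sets_F_P'[OF A] by (rule nn_integral_cmult_indicator[symmetric])
  also have "\<dots> \<le> emeasure P A"
    unfolding emeasure_eq_integral_ratio[OF A]
    by (intro nn_integral_mono) (auto simp: indicator_def ge)
  finally show ?thesis .
qed

text \<open>Splitting the union according to the first \<open>n\<close> with \<open>x \<in> E n\<close> makes the pieces disjoint and leaves
  the \<open>n\<close>-th piece in \<open>F n\<close>, where \<open>P\<close> and \<open>P'\<close> can be compared through \<open>ratio n\<close> alone. This is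
  Doob's maximal inequality; stating it for arbitrary \<open>E n\<close> rather than the full level sets allows
  restricting it to an event \<open>B\<close>, whose \<open>P\<close>-probability then replaces \<open>1\<close> in the bound.\<close>

lemma maximal_inequality:
  assumes E: "\<And>n. E n \<in> sets (F n)" and ge: "\<And>n x. x \<in> E n \<Longrightarrow> c \<le> ratio n x"
  shows "c * emeasure P' (\<Union>n. E n) \<le> emeasure P (\<Union>n. E n)"
proof -
  have D: "disjointed E n \<in> sets (F n)" for n
  proof -
    have "E i \<in> sets (F n)" if "i \<le> n" for i
      using E[of i] mono_F[OF that] by blast
    then show ?thesis
      unfolding disjointed_def by (intro sets.Diff sets.finite_UN) auto
  qed
  have "c * emeasure P' (\<Union>n. E n) = c * (\<Sum>n. emeasure P' (disjointed E n))"
    using sets_F_P'[OF D]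
    by (subst suminf_emeasure) (auto simp: disjoint_family_disjointed UN_disjointed_eq)
  also have "\<dots> = (\<Sum>n. c * emeasure P' (disjointed E n))"
    by simp
  also have "\<dots> \<le> (\<Sum>n. emeasure P (disjointed E n))"
  proof (rule suminf_le)
    show "c * emeasure P' (disjointed E n) \<le> emeasure P (disjointed E n)" for n
      by (rule emeasure_ge_where_ratio_ge[OF D]) (use ge disjointed_subset[of E n] in blast)
  qed simp_all
  also have "\<dots> = emeasure P (\<Union>n. E n)"
    using sets_F_P[OF D]
    by (subst suminf_emeasure) (auto simp: disjoint_family_disjointed UN_disjointed_eq)
  finally show ?thesis .
qed

section \<open>Vanishing ratios separate the two laws\<close>

text \<open>Almost sure convergence gives smallness in \<open>P'\<close>-probability, hence a time \<open>m k\<close> for each \<open>k\<close> at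
  which the set \<open>B k\<close> of small ratio is nearly full for \<open>P'\<close> and nearly null for \<open>P\<close>. The error
  bounds are summable, so the set of points lying in all but finitely many \<open>B k\<close> separates exactly.\<close>

lemma separating_set_of_ratio_tendsto_0:
  assumes lim: "AE x in P'. (\<lambda>n. ratio n x) \<longlonglongrightarrow> 0"
  shows "\<exists>A\<in>sets P. measure P A = 0 \<and> measure P' A = 1"
proof -
  \<comment> \<open>Any summable sequence of positive numbers would serve as threshold and as error bound.\<close>
  define c :: "nat \<Rightarrow> real" where "c k = (1/2)^k" for k
  have c_pos: "c k > 0" for k
    by (simp add: c_def)
  have "\<exists>n. measure P' {x\<in>space P'. ratio n x > c k} < c k" for k
  proof -
    define D where "D N = {x\<in>space P'. \<exists>n\<ge>N. ratio n x > c k}" for N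
    have D [measurable]: "D N \<in> sets P'" for N
      unfolding D_def by measurable
    have "AE x in P'. x \<notin> (\<Inter>N. D N)"
      using lim
    proof eventually_elim
      fix x assume "(\<lambda>n. ratio n x) \<longlonglongrightarrow> 0"
      then have "\<forall>\<^sub>F n in sequentially. ratio n x < c k"
        by (rule order_tendstoD) (simp add: c_pos)
      then obtain N where "ratio n x < c k" if "n \<ge> N" for n
        by (auto simp: eventually_sequentially)
      then show "x \<notin> (\<Inter>N. D N)"
        by (auto simp: D_def not_less intro!: exI[of _ N] less_imp_le)
    qed
    then have "measure P' (\<Inter>N. D N) = 0"
      by (subst P'.prob_eq_0) auto
    moreover have "(\<lambda>N. measure P' (D N)) \<longlonglongrightarrow> measure P' (\<Inter>N. D N)"
      by (rule P'.finite_Lim_measure_decseq) (auto simp: decseq_def D_def intro: order_trans)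
    ultimately have "\<forall>\<^sub>F N in sequentially. measure P' (D N) < c k"
      using c_pos[of k] by (auto dest: order_tendstoD(2))
    then obtain N where N: "measure P' (D N) < c k"
      by (auto simp: eventually_sequentially)
    have "measure P' {x\<in>space P'. ratio N x > c k} \<le> measure P' (D N)"
      by (intro P'.finite_measure_mono D) (auto simp: D_def)
    with N show ?thesis
      by (intro exI[of _ N]) simp
  qed
  then obtain m where m: "measure P' {x\<in>space P'. ratio (m k) x > c k} < c k" for k
    by metis
  define B where "B k = {x\<in>space P. ratio (m k) x \<le> c k}" for k
  have B [measurable]: "B k \<in> sets P" for k
    unfolding B_def by measurable
  have B' [measurable]: "B k \<in> sets P'" for k
    using B by (simp add: sets_P')
  have P_B: "measure P (B k) \<le> c k" for k
  proof -
    have "B k = {x\<in>space (F (m k)). ratio (m k) x \<le> c k}"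
      by (simp add: B_def)
    also have "\<dots> \<in> sets (F (m k))"
      by measurable
    finally have "emeasure P (B k) \<le> c k * emeasure P' (B k)"
      by (rule emeasure_le_where_ratio_le) (simp add: B_def)
    also have "\<dots> \<le> ennreal (c k) * 1"
      by (intro mult_left_mono P'.emeasure_le_1) simp
    finally show ?thesis
      using c_pos[of k] by (simp add: P.emeasure_eq_measure)
  qed
  have P'_B: "measure P' (space P' - B k) < c k" for k
  proof -
    have "space P' - B k = {x\<in>space P'. ratio (m k) x > c k}"
      by (auto simp: B_def space_P' not_le)
    with m[of k] show ?thesis
      by simp
  qed
  have summable_c: "summable c"
    unfolding c_def by (rule summable_geometric) simp
  define A where "A = {x\<in>space P. \<forall>\<^sub>F k in sequentially. x \<in> B k}"
  have A [measurable]: "A \<in> sets P"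
    unfolding A_def by measurable
  have "AE x in P. \<forall>\<^sub>F k in sequentially. x \<in> space P - B k"
    by (rule borel_cantelli_AE1)
      (auto simp: P.emeasure_eq_measure intro!: summable_comparison_test'[OF summable_c, of 0] P_B)
  then have "AE x in P. x \<notin> A"
  proof eventually_elim
    fix x assume "\<forall>\<^sub>F k in sequentially. x \<in> space P - B k"
    then obtain N where "x \<notin> B k" if "k \<ge> N" for k
      by (auto simp: eventually_sequentially)
    then have "\<not> (\<forall>\<^sub>F k in sequentially. x \<in> B k)"
      unfolding eventually_sequentially by (meson max.cobounded1 max.cobounded2)
    then show "x \<notin> A"
      by (simp add: A_def)
  qed
  then have "measure P A = 0"
    by (simp add: P.prob_eq_0 A)
  moreover have "AE x in P'. \<forall>\<^sub>F k in sequentially. x \<in> space P' - (space P' - B k)"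
    by (rule borel_cantelli_AE1)
      (auto simp: P'.emeasure_eq_measure less_imp_le[OF P'_B]
        intro!: summable_comparison_test'[OF summable_c, of 0])
  then have "AE x in P'. x \<in> A"
    by eventually_elim (auto simp: A_def space_P' eventually_sequentially)
  then have "measure P' A = 1"
    using A by (simp add: P'.prob_eq_1 sets_P')
  ultimately show ?thesis
    using A by blast
qed

section \<open>Approximation by events of the filtration\<close>

text \<open>One set has to be close to \<open>A\<close> under both laws at once, since the maximal inequality compares the
  two laws on the same event.\<close>

definition approximable :: "'a set \<Rightarrow> bool" where
  "approximable A \<longleftrightarrow> (\<forall>e>0. \<exists>n. \<exists>B\<in>sets (F n).
     measure P (sym_diff A B) < e \<and> measure P' (sym_diff A B) < e)"

lemma approximable_of_sets_F:
  assumes "A \<in> sets (F n)"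
  shows "approximable A"
  unfolding approximable_def
proof (intro allI impI)
  fix e :: real assume "e > 0"
  with assms show "\<exists>n. \<exists>B\<in>sets (F n). measure P (sym_diff A B) < e \<and> measure P' (sym_diff A B) < e"
    by (intro exI[of _ n] bexI[of _ A]) auto
qed

lemma approximable_Compl:
  assumes "approximable A" and "A \<in> sets P"
  shows "approximable (space P - A)"
  unfolding approximable_def
proof (intro allI impI)
  fix e :: real assume "e > 0"
  then obtain n B where B: "B \<in> sets (F n)"
      "measure P (sym_diff A B) < e" "measure P' (sym_diff A B) < e"
    using assms(1) unfolding approximable_def by blast
  have "A \<subseteq> space P" "B \<subseteq> space P"
    using assms(2) sets_F_P[OF B(1)] by (auto dest: sets.sets_into_space)
  then have "sym_diff (space P - A) (space P - B) = sym_diff A B"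
    by blast
  moreover have "space P - B \<in> sets (F n)"
    using sets.compl_sets[OF B(1)] by simp
  ultimately show "\<exists>n. \<exists>B\<in>sets (F n). measure P (sym_diff (space P - A) B) < e
      \<and> measure P' (sym_diff (space P - A) B) < e"
    using B by (intro exI[of _ n] bexI[of _ "space P - B"]) auto
qed

text \<open>Half of the error budget pays for truncating the union to finitely many \<open>A i\<close>, the other half
  is shared between these.\<close>

lemma approximable_UN:
  fixes A :: "nat \<Rightarrow> 'a set"
  assumes approx: "\<And>i. approximable (A i)" and A: "\<And>i. A i \<in> sets P"
  shows "approximable (\<Union>i. A i)"
  unfolding approximable_def
proof (intro allI impI)
  fix e :: real assume e: "e > 0"
  define D where "D N = (\<Union>i. A i) - (\<Union>i<N. A i)" for N
  have D [measurable]: "D N \<in> sets P" for N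
    using A by (auto simp: D_def)
  have D_dec: "decseq D" and D_empty: "(\<Inter>N. D N) = {}"
    by (auto simp: D_def decseq_def)
  have D': "D N \<in> sets P'" for N
    using D by (simp add: sets_P')
  have lim: "(\<lambda>N. measure P (D N)) \<longlonglongrightarrow> 0" "(\<lambda>N. measure P' (D N)) \<longlonglongrightarrow> 0"
    using P.finite_Lim_measure_decseq[OF _ D_dec] P'.finite_Lim_measure_decseq[OF _ D_dec] D D'
    by (auto simp: D_empty image_subset_iff)
  have "\<forall>\<^sub>F N in sequentially. measure P (D N) < e/2 \<and> measure P' (D N) < e/2"
    using e by (intro eventually_conj order_tendstoD(2)[OF lim(1)] order_tendstoD(2)[OF lim(2)]) simp_all
  then obtain N where N: "measure P (D N) < e/2" "measure P' (D N) < e/2"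
    by (auto simp: eventually_sequentially)
  define \<delta> where "\<delta> = e / (2 * (real N + 1))"
  have \<delta>: "\<delta> > 0" "N * \<delta> \<le> e/2"
    using e by (auto simp: \<delta>_def field_simps)
  obtain n B where B: "B i \<in> sets (F (n i))"
      "measure P (sym_diff (A i) (B i)) < \<delta>" "measure P' (sym_diff (A i) (B i)) < \<delta>" for i
  proof -
    have "\<forall>i. \<exists>n B. B \<in> sets (F n) \<and>
        measure P (sym_diff (A i) B) < \<delta> \<and> measure P' (sym_diff (A i) B) < \<delta>"
      using approx \<delta>(1) unfolding approximable_def by blast
    then show thesis
      using that by (auto dest!: choice)
  qed
  define k where "k = Max (insert 0 (n ` {..<N}))"
  have "B i \<in> sets (F k)" if "i < N" for i
    using B(1)[of i] mono_F[of "n i" k] that by (auto simp: k_def)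
  then have B_k: "(\<Union>i<N. B i) \<in> sets (F k)"
    by auto
  have B_P: "B i \<in> sets P" for i
    by (rule sets_F_P[OF B(1)])
  have bound: "measure L (sym_diff (\<Union>i. A i) (\<Union>i<N. B i)) < e"
    if L: "prob_space L" "sets L = sets P" "measure L (D N) < e/2"
      "\<And>i. measure L (sym_diff (A i) (B i)) < \<delta>" for L
  proof -
    interpret L: prob_space L by fact
    have [measurable]: "A i \<in> sets L" "B i \<in> sets L" "D i \<in> sets L" for i
      using A B_P D by (auto simp: L)
    have "measure L (sym_diff (\<Union>i. A i) (\<Union>i<N. B i))
        \<le> measure L (D N \<union> (\<Union>i<N. sym_diff (A i) (B i)))"
      by (rule L.finite_measure_mono) (auto simp: D_def)
    also have "\<dots> \<le> measure L (D N) + measure L (\<Union>i<N. sym_diff (A i) (B i))"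
      by (rule measure_Un_le) auto
    also have "measure L (\<Union>i<N. sym_diff (A i) (B i)) \<le> (\<Sum>i<N. measure L (sym_diff (A i) (B i)))"
      by (rule measure_UNION_le) auto
    also have "\<dots> \<le> (\<Sum>i<N. \<delta>)"
      by (intro sum_mono less_imp_le L(4))
    also have "\<dots> \<le> e/2"
      using \<delta>(2) by simp
    finally show ?thesis
      using L(3) by simp
  qed
  show "\<exists>n. \<exists>C\<in>sets (F n). measure P (sym_diff (\<Union>i. A i) C) < e
      \<and> measure P' (sym_diff (\<Union>i. A i) C) < e"
    using B_k bound[OF P.prob_space_axioms] bound[OF P'.prob_space_axioms] N B(2,3) sets_P'
    by (intro exI[of _ k] bexI[of _ "\<Union>i<N. B i"]) auto
qed

text \<open>The approximable sets contain every \<open>F n\<close> and are closed under complements and countable unions.\<close>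

lemma approximation_by_filtration:
  assumes gen: "sets P = sigma_sets (space P) (\<Union>n. sets (F n))" and A: "A \<in> sets P"
  shows "approximable A"
  using A unfolding gen
proof (induction rule: sigma_sets.induct)
  case (Basic A)
  then show ?case by (auto intro: approximable_of_sets_F)
next
  case Empty
  show ?case by (rule approximable_of_sets_F[of _ 0]) simp
next
  case (Compl A)
  then show ?case by (intro approximable_Compl) (simp_all add: gen)
next
  case (Union A)
  then show ?case by (intro approximable_UN) (simp_all add: gen)
qed

section \<open>Separated laws have vanishing ratios\<close>

text \<open>A point where the ratio reaches \<open>c\<close> infinitely often either lies outside an approximation \<open>B\<close> of
  \<open>A\<close>, which is rare under \<open>P'\<close>, or is caught by a crossing inside \<open>B\<close>, which is rare under \<open>P'\<close>
  because \<open>P B\<close> is small.\<close>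

lemma ratio_tendsto_0_of_separating_set:
  assumes gen: "sets P = sigma_sets (space P) (\<Union>n. sets (F n))"
    and A: "A \<in> sets P" "measure P A = 0" "measure P' A = 1"
  shows "AE x in P'. (\<lambda>n. ratio n x) \<longlonglongrightarrow> 0"
proof -
  have eventually_small: "AE x in P'. \<forall>\<^sub>F n in sequentially. ratio n x < c" if c: "c > 0" for c :: real
  proof -
    define G where "G = {x\<in>space P'. \<not> (\<forall>\<^sub>F n in sequentially. ratio n x < c)}"
    have G [measurable]: "G \<in> sets P'"
      unfolding G_def by measurable
    have "measure P' G \<le> \<delta> + \<delta> / c" if \<delta>: "\<delta> > 0" for \<delta>
    proof -
      obtain m B where B: "B \<in> sets (F m)"
          "measure P (sym_diff A B) < \<delta>" "measure P' (sym_diff A B) < \<delta>"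
        using approximation_by_filtration[OF gen A(1)] \<delta> unfolding approximable_def by blast
      note B_P = sets_F_P[OF B(1)] and B_P' = sets_F_P'[OF B(1)]
      have A_P': "A \<in> sets P'"
        using A(1) by (simp add: sets_P')
      have "measure P B \<le> measure P (A \<union> sym_diff A B)"
        using A(1) B_P by (intro P.finite_measure_mono) auto
      also have "\<dots> \<le> measure P A + measure P (sym_diff A B)"
        using A(1) B_P by (intro measure_Un_le) auto
      finally have P_B: "measure P B < \<delta>"
        using A(2) B(2) by simp
      have "measure P' (space P' - B) \<le> measure P' ((space P' - A) \<union> sym_diff A B)"
        using A_P' B_P' by (intro P'.finite_measure_mono) auto
      also have "\<dots> \<le> measure P' (space P' - A) + measure P' (sym_diff A B)"
        using A_P' B_P' by (intro measure_Un_le) auto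
      also have "measure P' (space P' - A) = 0"
        using P'.prob_compl[OF A_P'] A(3) by simp
      finally have P'_B: "measure P' (space P' - B) < \<delta>"
        using B(3) by simp
      \<comment> \<open>Before time \<open>m\<close> the event \<open>B\<close> is not yet decided, so crossings are counted from \<open>m\<close> on.\<close>
      define E where "E n = (if m \<le> n then B \<inter> {x\<in>space P. c \<le> ratio n x} else {})" for n
      have E: "E n \<in> sets (F n)" for n
      proof -
        have "{x\<in>space (F n). c \<le> ratio n x} \<in> sets (F n)"
          by measurable
        then show ?thesis
          using B(1) mono_F[of m n] by (auto simp: E_def)
      qed
      have "c * emeasure P' (\<Union>n. E n) \<le> emeasure P (\<Union>n. E n)"
        by (rule maximal_inequality[OF E]) (auto simp: E_def split: if_splits)
      also have "\<dots> \<le> emeasure P B"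
        by (rule emeasure_mono[OF _ B_P]) (auto simp: E_def split: if_splits)
      finally have "c * measure P' (\<Union>n. E n) \<le> measure P B"
        using c by (simp add: P.emeasure_eq_measure P'.emeasure_eq_measure flip: ennreal_mult')
      then have P'_E: "measure P' (\<Union>n. E n) \<le> \<delta> / c"
        using P_B c by (simp add: field_simps)
      have [measurable]: "(\<Union>n. E n) \<in> sets P'"
        using sets_F_P'[OF E] by blast
      have "G \<subseteq> (space P' - B) \<union> (\<Union>n. E n)"
      proof
        fix x assume x: "x \<in> G"
        then obtain n where "n \<ge> m" "c \<le> ratio n x"
          by (auto simp: G_def eventually_sequentially not_less)
        with x show "x \<in> (space P' - B) \<union> (\<Union>n. E n)"
          by (auto simp: G_def E_def space_P')
      qed
      then have "measure P' G \<le> measure P' ((space P' - B) \<union> (\<Union>n. E n))"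
        using B_P' by (intro P'.finite_measure_mono) auto
      also have "\<dots> \<le> measure P' (space P' - B) + measure P' (\<Union>n. E n)"
        using B_P' by (intro measure_Un_le) auto
      finally show ?thesis
        using P'_B P'_E by simp
    qed
    moreover have "((\<lambda>\<delta>. \<delta> + \<delta> / c) \<longlongrightarrow> 0 + 0 / c) (at_right 0)"
      using c by (intro tendsto_intros) auto
    ultimately have "measure P' G \<le> 0"
      by (intro tendsto_lowerbound[where F = "at_right 0" and f = "\<lambda>\<delta>. \<delta> + \<delta> / c"])
        (auto simp: eventually_at_right_less intro: eventually_mono[OF eventually_at_right_less])
    then have "measure P' G = 0"
      by (simp add: measure_le_0_iff)
    then have "AE x in P'. x \<notin> G"
      by (simp add: P'.prob_eq_0)
    then show ?thesis
      using AE_space by eventually_elim (auto simp: G_def)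
  qed
  have "AE x in P'. \<forall>k. \<forall>\<^sub>F n in sequentially. ratio n x < ennreal (1 / Suc k)"
    unfolding AE_all_countable using eventually_small by simp
  then show ?thesis
  proof eventually_elim
    fix x assume small: "\<forall>k. \<forall>\<^sub>F n in sequentially. ratio n x < ennreal (1 / Suc k)"
    show "(\<lambda>n. ratio n x) \<longlonglongrightarrow> 0"
    proof (rule order_tendstoI)
      fix a :: ennreal assume "0 < a"
      then obtain y where y: "0 < y" "y < a"
        using dense by blast
      then obtain b :: real where b: "0 < b" "ennreal b < a"
        by (cases y) (auto simp: less_top[symmetric])
      obtain k where "1 / Suc k < b"
        using b(1) nat_approx_posE by blast
      then have "ennreal (1 / Suc k) < a"
        using b by (meson ennreal_leI less_imp_le order_le_less_trans)
      with small[rule_format, of k] show "\<forall>\<^sub>F n in sequentially. ratio n x < a"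
        by (auto elim: eventually_mono)
    qed simp
  qed
qed

lemma separating_set_iff_ratio_tendsto_0:
  assumes "sets P = sigma_sets (space P) (\<Union>n. sets (F n))"
  shows "(\<exists>A\<in>sets P. measure P A = 0 \<and> measure P' A = 1) \<longleftrightarrow>
    (AE x in P'. (\<lambda>n. ratio n x) \<longlonglongrightarrow> 0)"
  using separating_set_of_ratio_tendsto_0 ratio_tendsto_0_of_separating_set[OF assms] by blast

end

section \<open>The state filtration and the laws of the state process\<close>

lemma space_state_filtration: "space (state_filtration S n) = space (trajectory_space S)"
  by (simp add: state_filtration_def)

lemma restrict_measurable_trajectory_space:
  "(\<lambda>x. \<lambda>i\<in>{..n}. x i) \<in> trajectory_space S \<rightarrow>\<^sub>M (\<Pi>\<^sub>M i\<in>{..n}. borel_on S)"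
  unfolding trajectory_space_def by (rule measurable_restrict_subset) simp

lemma subalgebra_state_filtration: "subalgebra (trajectory_space S) (state_filtration S n)"
proof -
  have "sets (state_filtration S n) \<subseteq> sets (trajectory_space S)"
    unfolding state_filtration_def
    by (rule sets_image_in_sets[OF refl restrict_measurable_trajectory_space])
  then show ?thesis
    by (simp add: subalgebra_def space_state_filtration)
qed

lemma coordinate_measurable_state_filtration:
  assumes "i \<le> n"
  shows "(\<lambda>x. x i) \<in> state_filtration S n \<rightarrow>\<^sub>M borel_on S"
proof -
  have "(\<lambda>x. \<lambda>i\<in>{..n}. x i) \<in> state_filtration S n \<rightarrow>\<^sub>M (\<Pi>\<^sub>M i\<in>{..n}. borel_on S)"
    unfolding state_filtration_def
    by (rule measurable_vimage_algebra1)
      (use measurable_space[OF restrict_measurable_trajectory_space] in blast)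
  then have "(\<lambda>x. (\<lambda>i\<in>{..n}. x i) i) \<in> state_filtration S n \<rightarrow>\<^sub>M borel_on S"
    by (rule measurable_compose) (use assms in \<open>auto intro: measurable_component_singleton\<close>)
  with assms show ?thesis
    by simp
qed

lemma state_filtration_mono:
  assumes "m \<le> n"
  shows "sets (state_filtration S m) \<subseteq> sets (state_filtration S n)"
proof -
  have "(\<lambda>x. \<lambda>i\<in>{..m}. x i) \<in> state_filtration S n \<rightarrow>\<^sub>M (\<Pi>\<^sub>M i\<in>{..m}. borel_on S)"
    by (rule measurable_restrict) (use assms in \<open>auto intro: coordinate_measurable_state_filtration\<close>)
  then show ?thesis
    unfolding state_filtration_def[of S m] space_state_filtration[of S n, symmetric]
    by (rule sets_image_in_sets[OF refl])
qed

lemma state_filtration_generates: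
  "sets (trajectory_space S) =
    sigma_sets (space (trajectory_space S)) (\<Union>n. sets (state_filtration S n))"
proof
  have sub: "sets (state_filtration S n) \<subseteq> sets (trajectory_space S)" for n
    using subalgebra_state_filtration[of S n] by (simp add: subalgebra_def)
  show "sigma_sets (space (trajectory_space S)) (\<Union>n. sets (state_filtration S n))
      \<subseteq> sets (trajectory_space S)"
    by (rule sets.sigma_sets_subset) (use sub in blast)
  have "{x \<in> space (trajectory_space S). x i \<in> A} \<in> (\<Union>n. sets (state_filtration S n))"
    if "A \<in> sets (borel_on S)" for i A
    using measurable_sets[OF coordinate_measurable_state_filtration[OF order_refl] that, of i]
    by (auto simp: space_state_filtration vimage_def Int_def conj_commute)
  then show "sets (trajectory_space S)
      \<subseteq> sigma_sets (space (trajectory_space S)) (\<Union>n. sets (state_filtration S n))"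
    unfolding trajectory_space_def sets_PiM_single space_PiM[symmetric]
    by (intro sigma_sets_mono') auto
qed

lemma sets_state_law [simp]: "sets (state_law S R) = sets (trajectory_space S)"
  and space_state_law [simp]: "space (state_law S R) = space (trajectory_space S)"
  by (simp_all add: state_law_def)

lemma prob_space_state_law:
  assumes "mdp_law S U \<kappa> \<nu> \<pi> R"
  shows "prob_space (state_law S R)"
proof -
  interpret R: prob_space R
    using assms by (simp add: mdp_law_def)
  have "sets R = sets (canonical_space S U)"
    using assms by (simp add: mdp_law_def)
  moreover have "(\<lambda>\<omega> t. state_at t \<omega>) \<in> canonical_space S U \<rightarrow>\<^sub>M trajectory_space S"
    unfolding canonical_space_def trajectory_space_def state_at_def
    by (rule measurable_PiM_single') (auto simp: space_PiM space_pair_measure PiE_iff mem_Times_iff)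
  ultimately show ?thesis
    unfolding state_law_def by (intro R.prob_space_distr) (simp cong: measurable_cong_sets)
qed

lemma separator_iff_separating_set:
  assumes "prob_space P" and "prob_space P'"
    and sets: "sets P = sets (trajectory_space S)" "sets P' = sets (trajectory_space S)"
  shows "(\<exists>\<Sigma>s. separator S P P' \<Sigma>s) \<longleftrightarrow> (\<exists>A\<in>sets P. measure P A = 0 \<and> measure P' A = 1)"
proof -
  interpret P: prob_space P by fact
  interpret P': prob_space P' by fact
  note space = sets_eq_imp_space_eq[OF sets(1)] sets_eq_imp_space_eq[OF sets(2)]
  show ?thesis
  proof
    assume "\<exists>\<Sigma>s. separator S P P' \<Sigma>s"
    then obtain \<Sigma>s where \<Sigma>s: "separator S P P' \<Sigma>s" ..
    then have meas: "\<Sigma>s \<in> trajectory_space S \<rightarrow>\<^sub>M count_space {0, 1}"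
      and AE: "AE x in P. \<Sigma>s x = 0" "AE x in P'. \<Sigma>s x = 1"
      by (simp_all add: separator_def)
    define A where "A = {x\<in>space (trajectory_space S). \<Sigma>s x = 1}"
    have "A = \<Sigma>s -` {1} \<inter> space (trajectory_space S)"
      by (auto simp: A_def)
    then have A: "A \<in> sets (trajectory_space S)"
      using measurable_sets[OF meas, of "{1}"] by simp
    have "AE x in P. x \<notin> A"
      using AE(1) by eventually_elim (simp add: A_def)
    moreover have "AE x in P'. x \<in> A"
      using AE(2) AE_space by eventually_elim (simp add: A_def space)
    ultimately show "\<exists>A\<in>sets P. measure P A = 0 \<and> measure P' A = 1"
      using A by (intro bexI[of _ A]) (simp_all add: sets P.prob_eq_0 P'.prob_eq_1)
  next
    assume "\<exists>A\<in>sets P. measure P A = 0 \<and> measure P' A = 1"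
    then obtain A where A: "A \<in> sets (trajectory_space S)" "measure P A = 0" "measure P' A = 1"
      by (auto simp: sets)
    have "AE x in P. x \<notin> A" "AE x in P'. x \<in> A"
      using A by (simp_all add: sets P.prob_eq_0[symmetric] P'.prob_eq_1[symmetric])
    moreover have "indicator A \<in> trajectory_space S \<rightarrow>\<^sub>M count_space {0, 1::nat}"
    proof (subst measurable_count_space_eq2; (intro conjI ballI)?)
      fix a :: nat assume "a \<in> {0, 1}"
      moreover have "indicator A -` {0::nat} = - A" "indicator A -` {1::nat} = A"
        by (auto simp: indicator_eq_0_iff indicator_eq_1_iff simp del: One_nat_def)
      ultimately show "indicator A -` {a} \<inter> space (trajectory_space S) \<in> sets (trajectory_space S)"
        using A(1) by (auto simp: Int_commute Diff_eq[symmetric])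
    qed (auto simp: indicator_def)
    ultimately have "separator S P P' (indicator A)"
      unfolding separator_def by (auto simp: indicator_def elim: eventually_mono)
    then show "\<exists>\<Sigma>s. separator S P P' \<Sigma>s"
      by (rule exI[where x = "indicator A"])
  qed
qed

theorem theorem4:
  fixes S :: "'a::euclidean_space set" and U :: "'b::euclidean_space set"
    and \<kappa> :: "'a \<times> 'b \<Rightarrow> 'a measure" and \<nu> :: "'a measure"
    and \<pi> \<pi>' :: "nat \<Rightarrow> (nat \<Rightarrow> 'a) \<times> (nat \<Rightarrow> 'b) \<Rightarrow> 'b measure"
    and R R' :: "(nat \<Rightarrow> 'a \<times> 'b) measure"
    and P P' :: "(nat \<Rightarrow> 'a) measure" and Q Q' :: "nat \<Rightarrow> (nat \<Rightarrow> 'a) measure"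
  assumes "S \<in> sets borel" and "S \<noteq> {}" and "U \<in> sets borel" and "U \<noteq> {}"
    and "transition_law S U \<kappa>"
    and "prob_space \<nu>" and "sets \<nu> = sets (borel_on S)"
    and "admissible_policy S U \<pi>" and "admissible_policy S U \<pi>'"
    and "mdp_law S U \<kappa> \<nu> \<pi> R" and "mdp_law S U \<kappa> \<nu> \<pi>' R'"
  defines "P \<equiv> state_law S R" and "P' \<equiv> state_law S R'"
  defines "Q \<equiv> \<lambda>n. restr_to_subalg P (state_filtration S n)"
    and "Q' \<equiv> \<lambda>n. restr_to_subalg P' (state_filtration S n)"
  assumes "\<And>n. absolutely_continuous (Q' n) (Q n)"
  shows "(\<exists>\<Sigma>s. separator S P P' \<Sigma>s) \<longleftrightarrow>
         (AE \<omega> in P'. (\<lambda>n. RN_deriv (Q' n) (Q n) \<omega>) \<longlonglongrightarrow> 0)"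
proof -
  have prob: "prob_space P" "prob_space P'"
    unfolding P_def P'_def using assms by (auto intro: prob_space_state_law)
  have sets: "sets P = sets (trajectory_space S)" "sets P' = sets (trajectory_space S)"
    by (simp_all add: P_def P'_def)
  note space = sets_eq_imp_space_eq[OF sets(1)]
  interpret P: prob_space P by (fact prob)
  interpret P': prob_space P' by (fact prob)
  interpret likelihood_ratios P P' "state_filtration S"
  proof
    show "sets P' = sets P"
      by (simp add: sets)
    show "subalgebra P (state_filtration S n)" for n
      using subalgebra_state_filtration[of S n] by (simp add: subalgebra_def sets space)
    show "absolutely_continuous (restr_to_subalg P' (state_filtration S n))
        (restr_to_subalg P (state_filtration S n))" for n
      using assms(16)[of n] by (simp add: Q_def Q'_def)
  qed (rule state_filtration_mono)
  have "sets P = sigma_sets (space P) (\<Union>n. sets (state_filtration S n))"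
    unfolding sets space by (rule state_filtration_generates)
  from separating_set_iff_ratio_tendsto_0[OF this] separator_iff_separating_set[OF prob sets]
  show ?thesis
    by (simp add: Q_def Q'_def ratio_def)
qed

end
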